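(* Let $Q\ge 0$ be an integer, let $\sigma_0,\dots,\sigma_Q>0$, and let $\lambda=(\lambda_0,\dots,\lambda_Q)$ with $\lambda_q\ge 0$ and $\sum_{q=0}^{Q}\lambda_q=1$. Then the convex combination of sliced Wasserstein kernels $$k_\lambda(D,D')=\sum_{q=0}^{Q}\lambda_q\,k_{H_q}(D,D'),\qquad D,D'\in\mathcal{D}_b^f(Q),$$ is a positive definite kernel on $\mathcal{D}_b^f(Q)$.
   Context: **Positive definite kernel.** A symmetric function $k:\mathcal{X}\times\mathcal{X}\to\mathbb{R}$ is a positive definite kernel if for all $n\in\mathbb{N}$, $x_1,\dots,x_n\in\mathcal{X}$ and $a_1,\dots,a_n\in\mathbb{R}$ one has $\sum_{i,j=1}^n a_ia_jk(x_i,x_j)\ge 0$ (non-strict inequality). **Diagrams.** Let $\Delta=\{(x,x): x>0\}$ be the diagonal and let $\pi_\Delta$ denote orthogonal projection onto the diagonal, $\pi_\Delta(x,y)=(\frac{x+y}{2},\frac{x+y}{2})$. A persistence diagram is a multiset of points of $\{(x,y): x>0,\,y>0\}\setminus\Delta$; it is finite and bounded if it has finitely many points (with multiplicity) contained in a bounded set. $\mathcal{D}_b^f(Q)$ is the set of finite bounded persistence diagrams $D$ whose points are graded by homology dimension and which have no points in dimension larger than $Q$; thus $D$ is given by its restrictions $D^{(0)},\dots,D^{(Q)}$, where $D^{(q)}$ is the (possibly empty) finite bounded persistence diagram formed by the points of $D$ coming from the $q$-th homology group. **Sliced Wasserstein distance.** For an angle $\theta$, let $\pi_\theta:\mathbb{R}^2\to\mathbb{R}$,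 $\pi_\theta(p)=\langle p,(\cos\theta,\sin\theta)\rangle$. For finite bounded diagrams $D_1,D_2$ set $\mu_i^\theta=\sum_{p\in D_i}\delta_{\pi_\theta(p)}$ and $\mu_{i\Delta}^\theta=\sum_{p\in D_i}\delta_{\pi_\theta(\pi_\Delta(p))}$ (with multiplicity), and $$\mathrm{SW}(D_1,D_2)=\frac1\pi\int_{-\pi/2}^{\pi/2}\mathcal{W}_1\big(\mu_1^\theta+\mu_{2\Delta}^\theta,\ \mu_2^\theta+\mu_{1\Delta}^\theta\big)\,d\theta,$$ where $\mathcal{W}_1$ is the $1$-Wasserstein distance (infimum over couplings of $\int|x-y|$, no normalization) between non-negative measures on $\mathbb{R}$ of equal total mass. **Kernels.** For $D,D'\in\mathcal{D}_b^f(Q)$, $k_{H_q}(D,D')=\exp\big(-\mathrm{SW}(D^{(q)},D'^{(q)})/(2\sigma_q^2)\big)$. *)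

theory Defs
  imports "HOL-Probability.Probability"
begin

definition positive_definite_kernel_on :: "'a set \<Rightarrow> ('a \<Rightarrow> 'a \<Rightarrow> real) \<Rightarrow> bool" where
  "positive_definite_kernel_on X k \<longleftrightarrow>
     (\<forall>x\<in>X. \<forall>y\<in>X. k x y = k y x) \<and>
     (\<forall>(n::nat) (x :: nat \<Rightarrow> 'a) (a :: nat \<Rightarrow> real). (\<forall>i\<in>{1..n}. x i \<in> X) \<longrightarrow>
        0 \<le> (\<Sum>i=1..n. \<Sum>j=1..n. a i * a j * k (x i) (x j)))"


section \<open>Diagrams\<close>

definition diagonal :: "(real \<times> real) set" where
  "diagonal = {(x, x) | x. x > 0}"

definition proj_diagonal :: "real \<times> real \<Rightarrow> real \<times> real" where
  "proj_diagonal p = ((fst p + snd p) / 2, (fst p + snd p) / 2)"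

definition diagram_points :: "(real \<times> real) set" where
  "diagram_points = {(x, y). x > 0 \<and> y > 0} - diagonal"

text \<open>
  Library multisets are finite, so a diagram represented by one is automatically finite and
  bounded. A graded diagram is a multiset of points tagged with their homology dimension.
\<close>

type_synonym diagram = "(real \<times> real) multiset"
type_synonym graded_diagram = "(nat \<times> (real \<times> real)) multiset"

definition graded_diagrams :: "nat \<Rightarrow> graded_diagram set" where
  "graded_diagrams Q = {D. \<forall>(q, p) \<in> set_mset D. q \<le> Q \<and> p \<in> diagram_points}"

definition dimension_part :: "graded_diagram \<Rightarrow> nat \<Rightarrow> diagram" where
  "dimension_part D q = image_mset snd (filter_mset (\<lambda>z. fst z = q) D)"


section \<open>The 1-Wasserstein distance on the real line\<close>

definition couplings :: "real measure \<Rightarrow> real measure \<Rightarrow> (real \<times> real) measure set" where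
  "couplings \<mu> \<nu> = {\<gamma>. sets \<gamma> = sets (borel \<Otimes>\<^sub>M borel) \<and>
     distr \<gamma> borel fst = \<mu> \<and> distr \<gamma> borel snd = \<nu>}"

text \<open>
  The total masses are not normalised. The infimum is taken in the extended reals, so its
  value is infinite if there is no coupling, i.e. if the total masses differ.
\<close>

definition wasserstein_1 :: "real measure \<Rightarrow> real measure \<Rightarrow> ennreal" where
  "wasserstein_1 \<mu> \<nu> = (INF \<gamma>\<in>couplings \<mu> \<nu>. \<integral>\<^sup>+ z. ennreal \<bar>fst z - snd z\<bar> \<partial>\<gamma>)"


section \<open>Sliced Wasserstein distance and kernels\<close>

definition dirac_sum :: "real multiset \<Rightarrow> real measure" where
  "dirac_sum M = measure_of UNIV (sets borel) (\<lambda>A. \<Sum>x\<in>#M. emeasure (return borel x) A)"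

lemma sets_dirac_sum [simp, measurable_cong]: "sets (dirac_sum M) = sets borel"
  using sets.sigma_sets_eq[of "borel :: real measure"] by (simp add: dirac_sum_def)

lemma space_dirac_sum [simp]: "space (dirac_sum M) = UNIV"
  by (simp add: dirac_sum_def)

lemma emeasure_dirac_sum:
  assumes "A \<in> sets borel"
  shows "emeasure (dirac_sum M) A = (\<Sum>x\<in>#M. emeasure (return borel x) A)"
proof (rule emeasure_measure_of[OF dirac_sum_def])
  show "countably_additive (sets (dirac_sum M)) (\<lambda>A. \<Sum>x\<in>#M. emeasure (return borel x) A)"
  proof (rule countably_additiveI)
    fix B :: "nat \<Rightarrow> real set"
    assume B: "range B \<subseteq> sets (dirac_sum M)" "disjoint_family B"
    show "(\<Sum>i. \<Sum>x\<in>#M. emeasure (return borel x) (B i)) =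
          (\<Sum>x\<in>#M. emeasure (return borel x) (\<Union>i. B i))"
    proof (induction M)
      case (add x M)
      have "(\<Sum>i. emeasure (return borel x) (B i)) = emeasure (return borel x) (\<Union>i. B i)"
        using B by (intro suminf_emeasure) auto
      with add show ?case by (simp add: suminf_add[symmetric])
    qed simp
  qed
qed (use assms in \<open>auto simp: positive_def\<close>)

text \<open>Addition of multisets is addition of the associated measures.\<close>

lemma emeasure_dirac_sum_add:
  assumes "A \<in> sets borel"
  shows "emeasure (dirac_sum (M + N)) A = emeasure (dirac_sum M) A + emeasure (dirac_sum N) A"
  using assms by (simp add: emeasure_dirac_sum)

definition proj_angle :: "real \<Rightarrow> real \<times> real \<Rightarrow> real" where
  "proj_angle \<theta> p = p \<bullet> (cos \<theta>, sin \<theta>)"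

text \<open>The measure of the first diagram plus that of the diagonal projection of the second.\<close>

definition sliced_measure :: "real \<Rightarrow> diagram \<Rightarrow> diagram \<Rightarrow> real measure" where
  "sliced_measure \<theta> D E = dirac_sum
     (image_mset (proj_angle \<theta>) D + image_mset (\<lambda>p. proj_angle \<theta> (proj_diagonal p)) E)"

definition sliced_wasserstein :: "diagram \<Rightarrow> diagram \<Rightarrow> real" where
  "sliced_wasserstein D\<^sub>1 D\<^sub>2 = 1 / pi * (LBINT \<theta>:{- pi / 2..pi / 2}.
     enn2real (wasserstein_1 (sliced_measure \<theta> D\<^sub>1 D\<^sub>2) (sliced_measure \<theta> D\<^sub>2 D\<^sub>1)))"

definition sw_kernel :: "real \<Rightarrow> nat \<Rightarrow> graded_diagram \<Rightarrow> graded_diagram \<Rightarrow> real" where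
  "sw_kernel s q D D' =
     exp (- sliced_wasserstein (dimension_part D q) (dimension_part D' q) / (2 * s\<^sup>2))"

end

theory Submission
  imports Defs
begin

text \<open>
  On the line, the 1-Wasserstein distance is the L1 distance of the distribution functions. The
  diagonal projections are added crosswise, so the difference of the two distribution functions
  in the sliced Wasserstein distance SW splits as f D - f E, where f D depends on D alone. Hence
  SW is an L1 distance over angles and thresholds. Pointwise, |a| + |b| - |a - b| is a sum of two
  min kernels, each an integral of rank one kernels, so
  K(D, E) = SW(D, 0) + SW(0, E) - SW(D, E), with 0 the empty diagram, is an integral of rank one
  kernels too. Kernels whose entrywise product with every positive semidefinite kernel is positive
  semidefinite are closed under integrals, products and limits, hence under exp. Finally
  exp(- c SW(D, E)) is exp(c K(D, E)) times a rank one kernel. Working with multipliers avoids the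
  Schur product theorem.
\<close>

section \<open>Schur multipliers\<close>

definition psd_on :: "'i set \<Rightarrow> ('i \<Rightarrow> 'i \<Rightarrow> real) \<Rightarrow> bool" where
  "psd_on I K \<longleftrightarrow> (\<forall>a. 0 \<le> (\<Sum>i\<in>I. \<Sum>j\<in>I. a i * a j * K i j))"

text \<open>Entrywise multiplication by \<open>K\<close> preserves the cone of positive semidefinite
  kernels. Products of multipliers are thus compositions of cone-preserving maps.\<close>

definition schur_multiplier :: "'i set \<Rightarrow> ('i \<Rightarrow> 'i \<Rightarrow> real) \<Rightarrow> bool" where
  "schur_multiplier I K \<longleftrightarrow> (\<forall>L. psd_on I L \<longrightarrow> psd_on I (\<lambda>i j. K i j * L i j))"

section \<open>Rank one kernels, products and nonnegative combinations\<close>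

lemma schur_multiplierI:
  assumes "\<And>L a. psd_on I L \<Longrightarrow> 0 \<le> (\<Sum>i\<in>I. \<Sum>j\<in>I. a i * a j * (K i j * L i j))"
  shows "schur_multiplier I K"
  using assms by (simp add: schur_multiplier_def psd_on_def)

lemma schur_multiplierD:
  assumes "schur_multiplier I K" "psd_on I L"
  shows "0 \<le> (\<Sum>i\<in>I. \<Sum>j\<in>I. a i * a j * (K i j * L i j))"
  using assms unfolding schur_multiplier_def psd_on_def by blast

lemma psd_on_rank_one: "psd_on I (\<lambda>i j. u i * u j)"
proof -
  have "(\<Sum>i\<in>I. \<Sum>j\<in>I. a i * a j * (u i * u j)) = (\<Sum>i\<in>I. a i * u i)\<^sup>2" for a
    by (simp add: power2_eq_square sum_product mult_ac)
  then show ?thesis by (simp add: psd_on_def)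
qed

text \<open>Test the multiplier on the constant kernel 1, which has rank one.\<close>

lemma schur_multiplier_imp_psd_on:
  assumes "schur_multiplier I K"
  shows "psd_on I K"
proof -
  have "psd_on I (\<lambda>i j. K i j * (1 * 1))"
    using assms psd_on_rank_one[of I "\<lambda>_. 1"] unfolding schur_multiplier_def by blast
  then show ?thesis by simp
qed

text \<open>The factors \<open>u i\<close> and \<open>u j\<close> can be absorbed into the
  coefficients \<open>a i\<close> and \<open>a j\<close>.\<close>

lemma schur_multiplier_rank_one: "schur_multiplier I (\<lambda>i j. u i * u j)"
proof (rule schur_multiplierI)
  fix L :: "'a \<Rightarrow> 'a \<Rightarrow> real" and a
  assume "psd_on I L"
  then have "\<forall>a. 0 \<le> (\<Sum>i\<in>I. \<Sum>j\<in>I. a i * a j * L i j)"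
    unfolding psd_on_def .
  then have "0 \<le> (\<Sum>i\<in>I. \<Sum>j\<in>I. (a i * u i) * (a j * u j) * L i j)"
    by (rule spec[where x = "\<lambda>i. a i * u i"])
  then show "0 \<le> (\<Sum>i\<in>I. \<Sum>j\<in>I. a i * a j * (u i * u j * L i j))" by (simp add: mult_ac)
qed

lemma schur_multiplier_mult:
  assumes "schur_multiplier I K" "schur_multiplier I K'"
  shows "schur_multiplier I (\<lambda>i j. K i j * K' i j)"
  unfolding schur_multiplier_def mult.assoc
proof (intro allI impI)
  fix L :: "'a \<Rightarrow> 'a \<Rightarrow> real"
  assume "psd_on I L"
  then have "psd_on I (\<lambda>i j. K' i j * L i j)"
    using assms(2) unfolding schur_multiplier_def by blast
  then show "psd_on I (\<lambda>i j. K i j * (K' i j * L i j))"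
    using assms(1) unfolding schur_multiplier_def by blast
qed

lemma schur_multiplier_power:
  assumes "schur_multiplier I K"
  shows "schur_multiplier I (\<lambda>i j. K i j ^ m)"
proof (induction m)
  case 0
  show ?case using schur_multiplier_rank_one[of I "\<lambda>_. 1"] by simp
next
  case (Suc m)
  show ?case unfolding power_Suc by (rule schur_multiplier_mult[OF assms Suc])
qed

text \<open>The constant kernel \<open>c\<close> has rank one, with
  \<open>u = sqrt c\<close>.\<close>

lemma schur_multiplier_scale:
  assumes "schur_multiplier I K" "0 \<le> c"
  shows "schur_multiplier I (\<lambda>i j. c * K i j)"
  using schur_multiplier_mult[OF schur_multiplier_rank_one[of I "\<lambda>_. sqrt c"] assms(1)] assms(2)
  by simp

lemma schur_multiplier_add:
  assumes "schur_multiplier I K" "schur_multiplier I K'"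
  shows "schur_multiplier I (\<lambda>i j. K i j + K' i j)"
proof (rule schur_multiplierI)
  fix L :: "'a \<Rightarrow> 'a \<Rightarrow> real" and a
  assume "psd_on I L"
  then have "0 \<le> (\<Sum>i\<in>I. \<Sum>j\<in>I. a i * a j * (K i j * L i j)) +
      (\<Sum>i\<in>I. \<Sum>j\<in>I. a i * a j * (K' i j * L i j))"
    by (intro add_nonneg_nonneg schur_multiplierD assms)
  then show "0 \<le> (\<Sum>i\<in>I. \<Sum>j\<in>I. a i * a j * ((K i j + K' i j) * L i j))"
    by (simp add: distrib_left distrib_right sum.distrib)
qed

lemma schur_multiplier_sum:
  assumes "finite S" "\<And>s. s \<in> S \<Longrightarrow> schur_multiplier I (K s)"
  shows "schur_multiplier I (\<lambda>i j. \<Sum>s\<in>S. K s i j)"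
  using assms
proof (induction S rule: finite_induct)
  case empty
  show ?case using schur_multiplier_rank_one[of I "\<lambda>_. 0"] by simp
next
  case (insert s S)
  then show ?case by (simp add: schur_multiplier_add)
qed

section \<open>Limits, exponentials and integrals of multipliers\<close>

text \<open>For fixed \<open>L\<close> and \<open>a\<close> the quadratic form is continuous in the
  entries, and nonnegativity survives limits.\<close>

lemma schur_multiplier_limit:
  assumes "\<And>m. schur_multiplier I (K m)"
    and "\<And>i j. (\<lambda>m. K m i j) \<longlonglongrightarrow> K' i j"
  shows "schur_multiplier I K'"
proof (rule schur_multiplierI)
  fix L :: "'a \<Rightarrow> 'a \<Rightarrow> real" and a
  assume L: "psd_on I L"
  show "0 \<le> (\<Sum>i\<in>I. \<Sum>j\<in>I. a i * a j * (K' i j * L i j))"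
  proof (rule LIMSEQ_le_const)
    show "(\<lambda>m. \<Sum>i\<in>I. \<Sum>j\<in>I. a i * a j * (K m i j * L i j))
      \<longlonglongrightarrow> (\<Sum>i\<in>I. \<Sum>j\<in>I. a i * a j * (K' i j * L i j))"
      by (intro tendsto_intros assms(2))
    show "\<exists>N. \<forall>m\<ge>N. 0 \<le> (\<Sum>i\<in>I. \<Sum>j\<in>I. a i * a j * (K m i j * L i j))"
      using schur_multiplierD[OF assms(1) L] by blast
  qed
qed

text \<open>The partial sums of the exponential series are nonnegative combinations of
  powers.\<close>

lemma schur_multiplier_exp:
  assumes "schur_multiplier I K"
  shows "schur_multiplier I (\<lambda>i j. exp (K i j))"
proof (rule schur_multiplier_limit)
  show "schur_multiplier I (\<lambda>i j. \<Sum>m<n. inverse (fact m) * K i j ^ m)" for n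
    by (intro schur_multiplier_sum schur_multiplier_scale schur_multiplier_power assms) auto
  show "(\<lambda>n. \<Sum>m<n. inverse (fact m) * K i j ^ m) \<longlonglongrightarrow> exp (K i j)" for i j
    using exp_converges[of "K i j"] by (simp add: sums_def)
qed

text \<open>The quadratic form is linear in the kernel, so it commutes with the integral of a
  pointwise nonnegative integrand.\<close>

lemma schur_multiplier_integral:
  fixes K :: "'z \<Rightarrow> 'i \<Rightarrow> 'i \<Rightarrow> real"
  assumes mult: "\<And>z. z \<in> space M \<Longrightarrow> schur_multiplier I (K z)"
    and int: "\<And>i j. i \<in> I \<Longrightarrow> j \<in> I \<Longrightarrow> integrable M (\<lambda>z. K z i j)"
  shows "schur_multiplier I (\<lambda>i j. \<integral>z. K z i j \<partial>M)"
proof (rule schur_multiplierI)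
  fix L :: "'i \<Rightarrow> 'i \<Rightarrow> real" and a
  assume L: "psd_on I L"
  have "0 \<le> (\<integral>z. (\<Sum>i\<in>I. \<Sum>j\<in>I. a i * a j * (K z i j * L i j)) \<partial>M)"
    by (intro integral_nonneg_AE AE_I2 schur_multiplierD mult L)
  also have "\<dots> = (\<Sum>i\<in>I. \<Sum>j\<in>I. a i * a j * ((\<integral>z. K z i j \<partial>M) * L i j))"
    by (simp add: int)
  finally show "0 \<le> (\<Sum>i\<in>I. \<Sum>j\<in>I. a i * a j * ((\<integral>z. K z i j \<partial>M) * L i j))" .
qed

section \<open>Kernels built from real-valued functions\<close>

text \<open>The minimum is the length of the intersection of \<open>{0..f i}\<close> and
  \<open>{0..f j}\<close>, hence the integral of a product of two indicators.\<close>

lemma schur_multiplier_min: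
  fixes f :: "'i \<Rightarrow> real"
  assumes "\<And>i. 0 \<le> f i"
  shows "schur_multiplier I (\<lambda>i j. min (f i) (f j))"
proof -
  have eq: "indicator {0..f i} s * indicator {0..f j} s = (indicator {0..min (f i) (f j)} s :: real)"
    for i j s by (auto simp: indicator_def)
  have "schur_multiplier I (\<lambda>i j. \<integral>s. indicator {0..f i} s * indicator {0..f j} s \<partial>lborel)"
    by (rule schur_multiplier_integral[OF schur_multiplier_rank_one])
      (auto simp: eq emeasure_lborel_Icc_eq intro!: integrable_real_indicator)
  then show ?thesis
    using assms by (simp add: eq)
qed

lemma schur_multiplier_abs_diff:
  fixes f :: "'i \<Rightarrow> real"
  shows "schur_multiplier I (\<lambda>i j. \<bar>f i\<bar> + \<bar>f j\<bar> - \<bar>f i - f j\<bar>)"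
proof -
  \<comment> \<open>For equal signs the left side is twice the smaller modulus, for opposite signs
    it is 0. The two minima treat positive and negative parts separately.\<close>
  have eq: "\<bar>x\<bar> + \<bar>y\<bar> - \<bar>x - y\<bar> = 2 * (min (max x 0) (max y 0) + min (max (- x) 0) (max (- y) 0))"
    for x y :: real by (auto simp: min_def max_def)
  show ?thesis unfolding eq
    by (intro schur_multiplier_scale schur_multiplier_add schur_multiplier_min) auto
qed


section \<open>The 1-Wasserstein distance between counting measures on the line\<close>

text \<open>The unnormalised distribution function of \<open>dirac_sum M\<close>.\<close>

definition multiset_cdf :: "real multiset \<Rightarrow> real \<Rightarrow> real" where
  "multiset_cdf M t = (\<Sum>x\<in>#M. indicator {x..} t)"

lemma multiset_cdf_add: "multiset_cdf (M + N) t = multiset_cdf M t + multiset_cdf N t"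
  by (simp add: multiset_cdf_def)

lemma multiset_cdf_mset: "multiset_cdf (mset xs) t = (\<Sum>i<length xs. indicator {xs ! i..} t)"
  unfolding multiset_cdf_def
  by (simp add: sum_mset_sum_list mset_map[symmetric] sum_list_sum_nth atLeast0LessThan del: mset_map)

lemma borel_measurable_multiset_cdf [measurable]: "multiset_cdf M \<in> borel_measurable borel"
proof (induction M)
  case (add x M)
  then show ?case by (simp add: multiset_cdf_def[abs_def])
qed (simp add: multiset_cdf_def[abs_def])

lemma abs_indicator_atLeast_diff:
  "\<bar>indicator {x..} t - indicator {y..} t\<bar> = (indicator {min x y..<max x y} t :: real)"
  for x y t :: real
  by (cases "x \<le> y") (auto simp: indicator_def)

text \<open>The integrand is 1 exactly at the thresholds separating the two points. This turns
  transport cost into an integral over thresholds.\<close>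

lemma nn_integral_abs_indicator_atLeast_diff:
  fixes x y :: real
  shows "(\<integral>\<^sup>+t. ennreal \<bar>indicator {x..} t - indicator {y..} t\<bar> \<partial>lborel) = ennreal \<bar>x - y\<bar>"
proof -
  have "max x y - min x y = \<bar>x - y\<bar>" by (simp add: min_def max_def)
  then show ?thesis
    by (simp add: abs_indicator_atLeast_diff ennreal_indicator)
qed

text \<open>Counting positions accounts for multiplicities, and two lists of equal length can be
  coupled through their common index set.\<close>

lemma dirac_sum_mset:
  "dirac_sum (mset xs) = distr (count_space {..<length xs}) borel ((!) xs)"
proof (rule measure_eqI)
  fix A assume "A \<in> sets (dirac_sum (mset xs))"
  then have A: "A \<in> sets borel" by simp
  have "emeasure (dirac_sum (mset xs)) A = (\<Sum>x\<leftarrow>xs. indicator A x)"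
    using A by (simp add: emeasure_dirac_sum sum_mset_sum_list mset_map[symmetric] del: mset_map)
  also have "\<dots> = (\<Sum>i<length xs. indicator A (xs ! i))"
    by (simp add: sum_list_sum_nth atLeast0LessThan)
  also have "\<dots> = (\<integral>\<^sup>+i. indicator A (xs ! i) \<partial>count_space {..<length xs})"
    by (simp add: nn_integral_count_space_finite)
  also have "\<dots> = (\<integral>\<^sup>+x. indicator A x \<partial>distr (count_space {..<length xs}) borel ((!) xs))"
    using A by (subst nn_integral_distr) auto
  finally show "emeasure (dirac_sum (mset xs)) A =
      emeasure (distr (count_space {..<length xs}) borel ((!) xs)) A"
    using A by simp
qed simp

lemma finite_measure_dirac_sum: "finite_measure (dirac_sum M)"
proof (rule finite_measureI)
  have "emeasure (dirac_sum M) UNIV = of_nat (size M)"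
    by (simp add: emeasure_dirac_sum)
  then show "emeasure (dirac_sum M) (space (dirac_sum M)) \<noteq> \<infinity>" by simp
qed

lemma integral_indicator_dirac_sum:
  "(\<integral>x. indicator {x..} t \<partial>dirac_sum M) = multiset_cdf M t"
proof -
  obtain xs where xs: "M = mset xs" using ex_mset by metis
  have "(\<integral>x. indicator {x..} t \<partial>dirac_sum M) = (\<integral>x. (indicator {..t} x :: real) \<partial>dirac_sum M)"
    by (intro Bochner_Integration.integral_cong) (auto simp: indicator_def)
  also have "\<dots> = (\<Sum>i<length xs. indicator {..t} (xs ! i))"
    unfolding xs dirac_sum_mset
    by (subst integral_distr) (auto simp: lebesgue_integral_count_space_finite)
  also have "\<dots> = multiset_cdf M t"
    unfolding xs multiset_cdf_mset by (intro sum.cong) (auto simp: indicator_def)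
  finally show ?thesis .
qed

text \<open>Write the cost as a double integral over pairs and thresholds and exchange the
  integrals. At a fixed threshold the marginals determine the integral of the signed difference,
  which is at most that of its absolute value.\<close>

lemma coupling_cost_ge:
  assumes "\<gamma> \<in> couplings (dirac_sum M) (dirac_sum N)"
  shows "(\<integral>\<^sup>+t. ennreal \<bar>multiset_cdf M t - multiset_cdf N t\<bar> \<partial>lborel)
    \<le> (\<integral>\<^sup>+z. ennreal \<bar>fst z - snd z\<bar> \<partial>\<gamma>)"
proof -
  have sets_\<gamma> [measurable_cong]: "sets \<gamma> = sets (borel \<Otimes>\<^sub>M borel)"
    and fst: "distr \<gamma> borel fst = dirac_sum M" and snd: "distr \<gamma> borel snd = dirac_sum N"
    using assms by (auto simp: couplings_def)
  have space_\<gamma>: "space \<gamma> = UNIV"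
    using sets_eq_imp_space_eq[OF sets_\<gamma>] by (simp add: space_pair_measure)
  have [measurable]: "fst \<in> measurable \<gamma> borel" "snd \<in> measurable \<gamma> borel" by measurable
  \<comment> \<open>The mass of \<gamma> equals that of its first marginal. Finiteness makes
    indicators integrable and permits the exchange of integrals.\<close>
  interpret \<gamma>: finite_measure \<gamma>
  proof
    have "emeasure \<gamma> (space \<gamma>) = emeasure (distr \<gamma> borel fst) UNIV"
      by (simp add: emeasure_distr space_\<gamma>)
    also have "\<dots> \<noteq> \<infinity>"
      using finite_measure.emeasure_finite[OF finite_measure_dirac_sum] fst by simp
    finally show "emeasure \<gamma> (space \<gamma>) \<noteq> \<infinity>" .
  qed
  interpret P: pair_sigma_finite \<gamma> lborel ..
  let ?d = "\<lambda>z t. indicator {fst z..} t - indicator {snd z..} t :: real"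
  have ind: "indicator {x..} t = (indicator {..t} x :: real)" for x t :: real
    by (auto simp: indicator_def)
  have int: "integrable \<gamma> (\<lambda>z. indicator {f z..} t :: real)"
    if [measurable]: "f \<in> borel_measurable \<gamma>" for f and t :: real
    unfolding ind by (rule \<gamma>.integrable_const_bound[where B = 1]) auto
  have [measurable]: "(\<lambda>(z, t). ?d z t) \<in> borel_measurable (\<gamma> \<Otimes>\<^sub>M lborel)"
    unfolding indicator_def atLeast_def by measurable
  have "(\<integral>\<^sup>+z. ennreal \<bar>fst z - snd z\<bar> \<partial>\<gamma>) = (\<integral>\<^sup>+z. \<integral>\<^sup>+t. ennreal \<bar>?d z t\<bar> \<partial>lborel \<partial>\<gamma>)"
    by (simp add: nn_integral_abs_indicator_atLeast_diff)
  also have "\<dots> = (\<integral>\<^sup>+t. \<integral>\<^sup>+z. ennreal \<bar>?d z t\<bar> \<partial>\<gamma> \<partial>lborel)"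
    by (rule P.Fubini'[symmetric]) measurable
  also have "\<dots> \<ge> (\<integral>\<^sup>+t. ennreal \<bar>multiset_cdf M t - multiset_cdf N t\<bar> \<partial>lborel)"
  proof (rule nn_integral_mono)
    fix t :: real
    have "(\<integral>z. ?d z t \<partial>\<gamma>) = (\<integral>z. indicator {fst z..} t \<partial>\<gamma>) - (\<integral>z. indicator {snd z..} t \<partial>\<gamma>)"
      by (intro Bochner_Integration.integral_diff int) auto
    also have "(\<integral>z. indicator {fst z..} t \<partial>\<gamma>) = multiset_cdf M t"
      unfolding integral_indicator_dirac_sum[symmetric] fst[symmetric] ind
      by (subst integral_distr) auto
    also have "(\<integral>z. indicator {snd z..} t \<partial>\<gamma>) = multiset_cdf N t"
      unfolding integral_indicator_dirac_sum[symmetric] snd[symmetric] ind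
      by (subst integral_distr) auto
    finally have "(\<integral>z. ?d z t \<partial>\<gamma>) = multiset_cdf M t - multiset_cdf N t" .
    moreover have "integrable \<gamma> (\<lambda>z. ?d z t)"
      by (intro Bochner_Integration.integrable_diff int) auto
    ultimately show "ennreal \<bar>multiset_cdf M t - multiset_cdf N t\<bar> \<le> (\<integral>\<^sup>+z. ennreal \<bar>?d z t\<bar> \<partial>\<gamma>)"
      using integral_norm_bound_ennreal[of \<gamma> "\<lambda>z. ?d z t"] by simp
  qed
  finally show ?thesis .
qed

text \<open>
  For sorted lists the indices of the entries below a threshold form initial segments, and these
  are nested, so no cancellation occurs in the difference of the two counts.
\<close>

lemma sum_abs_diff_indicator_sorted:
  fixes xs ys :: "real list"
  assumes "sorted xs" "sorted ys" "length xs = length ys"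
  shows "(\<Sum>i<length xs. \<bar>indicator {xs ! i..} t - indicator {ys ! i..} t :: real\<bar>) =
    \<bar>\<Sum>i<length xs. indicator {xs ! i..} t - indicator {ys ! i..} t\<bar>"
\<comment> \<open>One index with \<open>xs ! i \<le> t < ys ! i\<close> makes all terms nonnegative:
  up to \<open>i\<close> the entries of \<open>xs\<close> are at most \<open>t\<close>, beyond
  \<open>i\<close> those of \<open>ys\<close> exceed \<open>t\<close>. Without such an index no term
  is positive.\<close>
proof (cases "\<exists>i<length xs. xs ! i \<le> t \<and> t < ys ! i")
  case True
  then obtain i where i: "i < length xs" "xs ! i \<le> t" "t < ys ! i" by blast
  have nonneg: "0 \<le> (indicator {xs ! j..} t - indicator {ys ! j..} t :: real)"
    if "j < length xs" for j
  proof (cases "j \<le> i")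
    case True
    then have "xs ! j \<le> t" using sorted_nth_mono[OF assms(1) True i(1)] i by linarith
    then show ?thesis by (auto simp: indicator_def)
  next
    case False
    then have "ys ! i \<le> ys ! j" using assms that by (intro sorted_nth_mono) auto
    then show ?thesis using i by (auto simp: indicator_def)
  qed
  then have "0 \<le> (\<Sum>i<length xs. indicator {xs ! i..} t - indicator {ys ! i..} t :: real)"
    by (intro sum_nonneg) auto
  with nonneg show ?thesis by simp
next
  case False
  then have nonpos: "(indicator {xs ! j..} t - indicator {ys ! j..} t :: real) \<le> 0"
    if "j < length xs" for j
    using that by (auto simp: indicator_def not_less)
  then have "\<bar>\<Sum>i<length xs. indicator {xs ! i..} t - indicator {ys ! i..} t :: real\<bar> =
      - (\<Sum>i<length xs. indicator {xs ! i..} t - indicator {ys ! i..} t)"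
    by (intro abs_of_nonpos sum_nonpos) auto
  also have "\<dots> = (\<Sum>i<length xs. \<bar>indicator {xs ! i..} t - indicator {ys ! i..} t\<bar>)"
    unfolding sum_negf[symmetric] by (intro sum.cong refl abs_of_nonpos[symmetric] nonpos) auto
  finally show ?thesis by simp
qed

text \<open>The monotone coupling, matching the i-th smallest points, attains the lower bound
  because no cancellation occurs at any threshold.\<close>

lemma exists_optimal_coupling:
  assumes "size M = size N"
  obtains \<gamma> where "\<gamma> \<in> couplings (dirac_sum M) (dirac_sum N)"
    and "(\<integral>\<^sup>+z. ennreal \<bar>fst z - snd z\<bar> \<partial>\<gamma>) =
      (\<integral>\<^sup>+t. ennreal \<bar>multiset_cdf M t - multiset_cdf N t\<bar> \<partial>lborel)"
proof -
  define xs ys where "xs = sorted_list_of_multiset M" and "ys = sorted_list_of_multiset N"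
  have M: "M = mset xs" and N: "N = mset ys" and sorted: "sorted xs" "sorted ys"
    by (simp_all add: xs_def ys_def)
  have len: "length xs = length ys" using assms M N by simp
  define \<gamma> where
    "\<gamma> = distr (count_space {..<length xs}) (borel \<Otimes>\<^sub>M borel) (\<lambda>i. (xs ! i, ys ! i))"
  show thesis
  proof
    show "\<gamma> \<in> couplings (dirac_sum M) (dirac_sum N)"
    proof -
      have "(\<lambda>i. (xs ! i, ys ! i)) \<in> measurable (count_space {..<length xs}) (borel \<Otimes>\<^sub>M borel)"
        by (simp add: space_pair_measure)
      note distr_distr[OF measurable_fst this] distr_distr[OF measurable_snd this]
      then show ?thesis
        by (simp add: couplings_def \<gamma>_def M N dirac_sum_mset comp_def len)
    qed
    have "(\<integral>\<^sup>+z. ennreal \<bar>fst z - snd z\<bar> \<partial>\<gamma>) = (\<Sum>i<length xs. ennreal \<bar>xs ! i - ys ! i\<bar>)"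
      unfolding \<gamma>_def by (subst nn_integral_distr)
        (auto simp: nn_integral_count_space_finite space_pair_measure)
    also have "\<dots> = (\<integral>\<^sup>+t. (\<Sum>i<length xs.
        ennreal \<bar>indicator {xs ! i..} t - indicator {ys ! i..} t\<bar>) \<partial>lborel)"
      by (subst nn_integral_sum) (simp_all add: nn_integral_abs_indicator_atLeast_diff)
    also have "\<dots> = (\<integral>\<^sup>+t. ennreal \<bar>multiset_cdf M t - multiset_cdf N t\<bar> \<partial>lborel)"
      using sum_abs_diff_indicator_sorted[OF sorted len]
      by (simp add: M N multiset_cdf_mset sum_subtractf len)
    finally show "(\<integral>\<^sup>+z. ennreal \<bar>fst z - snd z\<bar> \<partial>\<gamma>) =
      (\<integral>\<^sup>+t. ennreal \<bar>multiset_cdf M t - multiset_cdf N t\<bar> \<partial>lborel)" .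
  qed
qed

lemma wasserstein_1_dirac_sum:
  assumes "size M = size N"
  shows "wasserstein_1 (dirac_sum M) (dirac_sum N) =
    (\<integral>\<^sup>+t. ennreal \<bar>multiset_cdf M t - multiset_cdf N t\<bar> \<partial>lborel)"
  unfolding wasserstein_1_def
proof (rule antisym)
  obtain \<gamma> where \<gamma>: "\<gamma> \<in> couplings (dirac_sum M) (dirac_sum N)"
    and cost: "(\<integral>\<^sup>+z. ennreal \<bar>fst z - snd z\<bar> \<partial>\<gamma>) =
      (\<integral>\<^sup>+t. ennreal \<bar>multiset_cdf M t - multiset_cdf N t\<bar> \<partial>lborel)"
    using exists_optimal_coupling[OF assms] .
  show "(INF \<gamma>\<in>couplings (dirac_sum M) (dirac_sum N). \<integral>\<^sup>+z. ennreal \<bar>fst z - snd z\<bar> \<partial>\<gamma>)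
      \<le> (\<integral>\<^sup>+t. ennreal \<bar>multiset_cdf M t - multiset_cdf N t\<bar> \<partial>lborel)"
    unfolding cost[symmetric] by (rule INF_lower[OF \<gamma>])
qed (intro INF_greatest coupling_cost_ge)


section \<open>The sliced Wasserstein distance as an L1 distance\<close>

text \<open>The function \<open>f D\<close> of the overview at angle \<theta>. Pairing each point
  with its diagonal projection gives summands of bounded support, whereas a single step function is
  not integrable.\<close>

definition sliced_profile :: "real \<Rightarrow> diagram \<Rightarrow> real \<Rightarrow> real" where
  "sliced_profile \<theta> D t = (\<Sum>p\<in>#D. indicator {proj_angle \<theta> p..} t -
     indicator {proj_angle \<theta> (proj_diagonal p)..} t)"

lemma sliced_profile_empty [simp]: "sliced_profile \<theta> {#} t = 0"
  by (simp add: sliced_profile_def)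

lemma sliced_profile_eq:
  "sliced_profile \<theta> D t = multiset_cdf (image_mset (proj_angle \<theta>) D) t -
     multiset_cdf (image_mset (\<lambda>p. proj_angle \<theta> (proj_diagonal p)) D) t"
  by (induction D) (simp_all add: sliced_profile_def multiset_cdf_def)

section \<open>Measurability and integrability of profiles\<close>

lemma borel_measurable_proj_angle [measurable]: "(\<lambda>\<theta>. proj_angle \<theta> p) \<in> borel_measurable borel"
  by (simp add: proj_angle_def inner_prod_def)

text \<open>Joint measurability is what makes the integral over \<open>t\<close> measurable in the
  angle.\<close>

lemma borel_measurable_sliced_profile [measurable]:
  "(\<lambda>(\<theta>, t). sliced_profile \<theta> D t) \<in> borel_measurable (borel \<Otimes>\<^sub>M borel)"
proof (induction D)
  case (add p D)
  have [measurable]: "(\<lambda>z. indicator {proj_angle (fst z) p..} (snd z) :: real)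
      \<in> borel_measurable (borel \<Otimes>\<^sub>M borel)" for p
    unfolding indicator_def atLeast_def by measurable
  note [measurable] = add[unfolded case_prod_beta]
  show ?case
    using add by (simp add: sliced_profile_def case_prod_beta)
qed (simp add: sliced_profile_def case_prod_beta)

lemma integrable_indicator_atLeast_diff:
  fixes x y :: real
  shows "integrable lborel (\<lambda>t. indicator {x..} t - indicator {y..} t :: real)"
proof (rule integrableI_bounded)
  show "(\<integral>\<^sup>+t. ennreal (norm (indicator {x..} t - indicator {y..} t :: real)) \<partial>lborel) < \<infinity>"
    by (simp add: nn_integral_abs_indicator_atLeast_diff)
qed simp

lemma integral_abs_indicator_atLeast_diff:
  fixes x y :: real
  shows "(\<integral>t. \<bar>indicator {x..} t - indicator {y..} t\<bar> \<partial>lborel) = \<bar>x - y\<bar>"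
  by (simp add: integral_eq_nn_integral nn_integral_abs_indicator_atLeast_diff)

lemma integrable_sliced_profile: "integrable lborel (sliced_profile \<theta> D)"
  by (induction D)
    (simp_all add: sliced_profile_def[abs_def] integrable_indicator_atLeast_diff)

text \<open>The bound is uniform in \<theta>, since projecting onto a unit vector does not increase
  the norm. It provides integrability over the angles.\<close>

lemma integral_abs_sliced_profile_le:
  "(\<integral>t. \<bar>sliced_profile \<theta> D t\<bar> \<partial>lborel) \<le> (\<Sum>p\<in>#D. norm p + norm (proj_diagonal p))"
proof (induction D)
  case (add p D)
  let ?d = "\<lambda>t. indicator {proj_angle \<theta> p..} t - indicator {proj_angle \<theta> (proj_diagonal p)..} t :: real"
  have proj: "\<bar>proj_angle \<theta> q\<bar> \<le> norm q" for q
    using Cauchy_Schwarz_ineq2[of q "(cos \<theta>, sin \<theta>)"] by (simp add: proj_angle_def norm_Pair)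
  have "(\<integral>t. \<bar>sliced_profile \<theta> (add_mset p D) t\<bar> \<partial>lborel)
      \<le> (\<integral>t. \<bar>?d t\<bar> + \<bar>sliced_profile \<theta> D t\<bar> \<partial>lborel)"
    by (intro integral_mono Bochner_Integration.integrable_add integrable_abs
        integrable_sliced_profile integrable_indicator_atLeast_diff)
      (simp add: sliced_profile_def)
  also have "\<dots> = (\<integral>t. \<bar>?d t\<bar> \<partial>lborel) + (\<integral>t. \<bar>sliced_profile \<theta> D t\<bar> \<partial>lborel)"
    by (intro Bochner_Integration.integral_add integrable_abs
        integrable_sliced_profile integrable_indicator_atLeast_diff)
  also have "(\<integral>t. \<bar>?d t\<bar> \<partial>lborel) \<le> norm p + norm (proj_diagonal p)"
    using proj[of p] proj[of "proj_diagonal p"] by (simp add: integral_abs_indicator_atLeast_diff)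
  finally show ?case using add by simp
qed simp

definition profile_dist :: "real \<Rightarrow> diagram \<Rightarrow> diagram \<Rightarrow> real" where
  "profile_dist \<theta> D E = (\<integral>t. \<bar>sliced_profile \<theta> D t - sliced_profile \<theta> E t\<bar> \<partial>lborel)"

lemma profile_dist_commute: "profile_dist \<theta> D E = profile_dist \<theta> E D"
  unfolding profile_dist_def by (intro Bochner_Integration.integral_cong) auto

lemma integrable_abs_sliced_profile_diff:
  "integrable lborel (\<lambda>t. \<bar>sliced_profile \<theta> D t - sliced_profile \<theta> E t\<bar>)"
  by (intro integrable_abs Bochner_Integration.integrable_diff integrable_sliced_profile)

text \<open>Both crosswise measures have \<open>size D + size E\<close> points, so the formula on
  the line applies. The integral is finite, so \<open>enn2real\<close> loses nothing.\<close>

lemma sliced_wasserstein_eq: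
  "sliced_wasserstein D E = 1 / pi * (LBINT \<theta>:{- pi / 2..pi / 2}. profile_dist \<theta> D E)"
proof -
  have "enn2real (wasserstein_1 (sliced_measure \<theta> D E) (sliced_measure \<theta> E D)) = profile_dist \<theta> D E"
    for \<theta>
  proof -
    have "wasserstein_1 (sliced_measure \<theta> D E) (sliced_measure \<theta> E D) =
        (\<integral>\<^sup>+t. ennreal \<bar>sliced_profile \<theta> D t - sliced_profile \<theta> E t\<bar> \<partial>lborel)"
      unfolding sliced_measure_def
      by (subst wasserstein_1_dirac_sum)
        (simp_all add: multiset_cdf_add sliced_profile_eq algebra_simps)
    then show ?thesis
      unfolding profile_dist_def
      using integrable_abs_sliced_profile_diff[of \<theta> D E]
      by (simp add: integral_eq_nn_integral borel_measurable_integrable)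
  qed
  then show ?thesis by (simp add: sliced_wasserstein_def)
qed

text \<open>A bounded measurable function on a bounded interval. Integrability allows the integral
  over angles to be split into its three terms later.\<close>

lemma set_integrable_profile_dist:
  "set_integrable lborel {- pi / 2..pi / 2} (\<lambda>\<theta>. profile_dist \<theta> D E)"
  unfolding set_integrable_def
proof (rule integrableI_bounded_set_indicator)
  let ?b = "\<lambda>D. \<Sum>p\<in>#D. norm p + norm (proj_diagonal p)"
  have "(\<lambda>(\<theta>, t). \<bar>sliced_profile \<theta> D t - sliced_profile \<theta> E t\<bar>)
      \<in> borel_measurable (borel \<Otimes>\<^sub>M borel)"
    using borel_measurable_abs[OF borel_measurable_diff[OF
        borel_measurable_sliced_profile[of D] borel_measurable_sliced_profile[of E]]]
    by (simp only: case_prod_unfold)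
  then have "(\<lambda>(\<theta>, t). \<bar>sliced_profile \<theta> D t - sliced_profile \<theta> E t\<bar>)
      \<in> borel_measurable (lborel \<Otimes>\<^sub>M lborel)"
    by (simp cong: measurable_cong_sets sets_pair_measure_cong)
  then show "(\<lambda>\<theta>. profile_dist \<theta> D E) \<in> borel_measurable lborel"
    unfolding profile_dist_def by (rule lborel.borel_measurable_lebesgue_integral)
  have "\<bar>profile_dist \<theta> D E\<bar> \<le> ?b D + ?b E" for \<theta>
  proof -
    have "\<bar>profile_dist \<theta> D E\<bar> \<le>
        (\<integral>t. \<bar>sliced_profile \<theta> D t\<bar> + \<bar>sliced_profile \<theta> E t\<bar> \<partial>lborel)"
      unfolding profile_dist_def
      by (subst abs_of_nonneg, simp)
        (intro integral_mono integrable_abs_sliced_profile_diff Bochner_Integration.integrable_add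
          integrable_abs integrable_sliced_profile, simp)
    also have "\<dots> = (\<integral>t. \<bar>sliced_profile \<theta> D t\<bar> \<partial>lborel) + (\<integral>t. \<bar>sliced_profile \<theta> E t\<bar> \<partial>lborel)"
      by (intro Bochner_Integration.integral_add integrable_abs integrable_sliced_profile)
    also have "\<dots> \<le> ?b D + ?b E"
      by (intro add_mono integral_abs_sliced_profile_le)
    finally show ?thesis .
  qed
  then show "AE \<theta> in lborel. \<theta> \<in> {- pi / 2..pi / 2} \<longrightarrow> norm (profile_dist \<theta> D E) \<le> ?b D + ?b E"
    by simp
  show "emeasure lborel {- pi / 2..pi / 2} < \<infinity>"
    by (rule emeasure_bounded_finite) simp
  show "{- pi / 2..pi / 2} \<in> sets lborel" by simp
qed

section \<open>Positive definiteness of the sliced Wasserstein kernels\<close>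

lemma sliced_wasserstein_commute: "sliced_wasserstein D E = sliced_wasserstein E D"
  unfolding sliced_wasserstein_eq profile_dist_commute[of _ D E] ..

text \<open>The kernel of \<open>schur_multiplier_abs_diff\<close>, applied to the profiles at each
  angle and threshold, is integrated over thresholds and then over angles.\<close>

lemma schur_multiplier_sliced_wasserstein:
  "schur_multiplier I (\<lambda>i j. sliced_wasserstein (D i) {#} + sliced_wasserstein (D j) {#} -
     sliced_wasserstein (D i) (D j))"
proof -
  let ?K = "\<lambda>\<theta> i j. profile_dist \<theta> (D i) {#} + profile_dist \<theta> (D j) {#} - profile_dist \<theta> (D i) (D j)"
  have K: "schur_multiplier I (?K \<theta>)" for \<theta>
  proof -
    let ?f = "\<lambda>i t. sliced_profile \<theta> (D i) t"
    \<comment> \<open>The empty diagram has profile 0, so the distances to it are the integrals of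
      \<open>\<bar>?f i t\<bar>\<close> and \<open>\<bar>?f j t\<bar>\<close>.\<close>
    have "?K \<theta> i j = (\<integral>t. \<bar>?f i t\<bar> + \<bar>?f j t\<bar> - \<bar>?f i t - ?f j t\<bar> \<partial>lborel)" for i j
      by (simp add: profile_dist_def integrable_sliced_profile)
    moreover have "schur_multiplier I
        (\<lambda>i j. \<integral>t. \<bar>?f i t\<bar> + \<bar>?f j t\<bar> - \<bar>?f i t - ?f j t\<bar> \<partial>lborel)"
      by (rule schur_multiplier_integral[OF schur_multiplier_abs_diff])
        (intro Bochner_Integration.integrable_diff Bochner_Integration.integrable_add integrable_abs
          integrable_sliced_profile)
    ultimately show ?thesis by simp
  qed
  let ?A = "{- pi / 2..pi / 2}"
  have int: "integrable lborel (\<lambda>\<theta>. indicator ?A \<theta> * profile_dist \<theta> E E')" for E E'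
    using set_integrable_profile_dist unfolding set_integrable_def real_scaleR_def .
  have split: "indicator ?A \<theta> * ?K \<theta> i j = indicator ?A \<theta> * profile_dist \<theta> (D i) {#} +
      indicator ?A \<theta> * profile_dist \<theta> (D j) {#} - indicator ?A \<theta> * profile_dist \<theta> (D i) (D j)"
    for \<theta> i j
    by (simp only: distrib_left right_diff_distrib)
  have "schur_multiplier I (\<lambda>i j. \<integral>\<theta>. indicator ?A \<theta> * ?K \<theta> i j \<partial>lborel)"
  proof (rule schur_multiplier_integral)
    show "integrable lborel (\<lambda>\<theta>. indicator ?A \<theta> * ?K \<theta> i j)" for i j
      unfolding split
      by (intro Bochner_Integration.integrable_diff Bochner_Integration.integrable_add int)
  qed (rule schur_multiplier_scale[OF K], simp)
  then have "schur_multiplier I (\<lambda>i j. 1 / pi * (\<integral>\<theta>. indicator ?A \<theta> * ?K \<theta> i j \<partial>lborel))"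
    by (rule schur_multiplier_scale) simp
  moreover have "1 / pi * (\<integral>\<theta>. indicator ?A \<theta> * ?K \<theta> i j \<partial>lborel) =
      sliced_wasserstein (D i) {#} + sliced_wasserstein (D j) {#} - sliced_wasserstein (D i) (D j)"
    for i j
  proof -
    have "(\<integral>\<theta>. indicator ?A \<theta> * ?K \<theta> i j \<partial>lborel) =
        (LBINT \<theta>:?A. profile_dist \<theta> (D i) {#}) + (LBINT \<theta>:?A. profile_dist \<theta> (D j) {#}) -
        (LBINT \<theta>:?A. profile_dist \<theta> (D i) (D j))"
      unfolding split set_lebesgue_integral_def real_scaleR_def
      by (subst Bochner_Integration.integral_diff Bochner_Integration.integral_add;
          (intro Bochner_Integration.integrable_add int)?)+ (rule refl)
    then show ?thesis
      by (simp only: sliced_wasserstein_eq distrib_left right_diff_distrib)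
  qed
  ultimately show ?thesis by (simp only:)
qed

lemma schur_multiplier_sw_kernel: "schur_multiplier I (\<lambda>i j. sw_kernel s q (D i) (D j))"
proof -
  let ?D = "\<lambda>i. dimension_part (D i) q"
  \<comment> \<open>These factors cancel the two distances to the empty diagram that
    \<open>?K\<close> contributes to the exponent.\<close>
  let ?u = "\<lambda>i. exp (- (1 / (2 * s\<^sup>2) * sliced_wasserstein (?D i) {#}))"
  let ?K = "\<lambda>i j. sliced_wasserstein (?D i) {#} + sliced_wasserstein (?D j) {#} -
     sliced_wasserstein (?D i) (?D j)"
  have "schur_multiplier I (\<lambda>i j. exp (1 / (2 * s\<^sup>2) * ?K i j) * (?u i * ?u j))"
    by (intro schur_multiplier_mult schur_multiplier_exp schur_multiplier_scale
        schur_multiplier_sliced_wasserstein schur_multiplier_rank_one) simp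
  moreover have "exp (1 / (2 * s\<^sup>2) * ?K i j) * (?u i * ?u j) = sw_kernel s q (D i) (D j)" for i j
    unfolding sw_kernel_def exp_add[symmetric]
    by (simp add: right_diff_distrib distrib_left diff_divide_distrib add_divide_distrib)
  ultimately show ?thesis by simp
qed

theorem proposition3p2:
  fixes Q :: nat and \<sigma> :: "nat \<Rightarrow> real" and lam :: "nat \<Rightarrow> real"
  assumes "\<And>q. q \<le> Q \<Longrightarrow> \<sigma> q > 0"
    and "\<And>q. q \<le> Q \<Longrightarrow> lam q \<ge> 0"
    and "(\<Sum>q=0..Q. lam q) = 1"
  shows "positive_definite_kernel_on (graded_diagrams Q)
    (\<lambda>D D'. \<Sum>q=0..Q. lam q * sw_kernel (\<sigma> q) q D D')"
  unfolding positive_definite_kernel_on_def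
proof (intro conjI ballI allI impI)
  show "(\<Sum>q=0..Q. lam q * sw_kernel (\<sigma> q) q D D') = (\<Sum>q=0..Q. lam q * sw_kernel (\<sigma> q) q D' D)"
    for D D'
    by (simp add: sw_kernel_def sliced_wasserstein_commute)
next
  fix n :: nat and D :: "nat \<Rightarrow> graded_diagram" and a :: "nat \<Rightarrow> real"
  \<comment> \<open>The kernel is pulled back along \<open>D\<close> to the index set, so repeated
    diagrams cause no difficulty.\<close>
  have "schur_multiplier {1..n} (\<lambda>i j. \<Sum>q=0..Q. lam q * sw_kernel (\<sigma> q) q (D i) (D j))"
    by (intro schur_multiplier_sum schur_multiplier_scale schur_multiplier_sw_kernel assms(2)) auto
  then show "0 \<le> (\<Sum>i=1..n. \<Sum>j=1..n.
      a i * a j * (\<Sum>q=0..Q. lam q * sw_kernel (\<sigma> q) q (D i) (D j)))"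
    by (blast dest: schur_multiplier_imp_psd_on[unfolded psd_on_def])
qed

end
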